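(* Let $A\cdot x=y$ be a right system of linear equations with matrix of coefficients $A\in \mathrm{M}(n,\mathbf{H})$, column of constants $y=(y_1,\ldots,y_n)^T\in\mathbf{H}^{n\times 1}$ and column of unknowns $x=(x_1,\ldots,x_n)^T$. If $\mathrm{ddet}\,A\neq 0$, then the solution to this linear system is given by components $$x_j=\frac{\mathrm{cdet}_j\,(A^*A)_{.j}(f)}{\mathrm{ddet}\,A},\qquad j=1,\ldots,n,$$ where $f=A^*y$.
   Context: $\mathbf{H}$ is the skew field of real quaternions; $\mathrm{M}(n,\mathbf{H})$ is the ring of $n\times n$ matrices over $\mathbf{H}$; $A^*$ is the conjugate transpose of $A$; a matrix $B$ is Hermitian if $B=B^*$. Column determinants: for $A=(a_{pq})\in \mathrm{M}(n,\mathbf{H})$ and $j\in\{1,\ldots,n\}$, $$\mathrm{cdet}_j A=\sum_{\tau\in S_n}(-1)^{n-r}a_{j_{k_r}j_{k_r+l_r}}\cdots a_{j_{k_r+1}j_{k_r}}\cdots a_{j\,j_{k_1+l_1}}\cdots a_{j_{k_1+1}j_{k_1}}a_{j_{k_1}j},$$ where each $\tau\in S_n$ is written as a product of its $r$ disjoint cycles (fixed points included) $\tau=(j_{k_r+l_r}\ldots j_{k_r+1}j_{k_r})\ldots(j_{k_2+l_2}\ldots j_{k_2+1}j_{k_2})(j_{k_1+l_1}\ldots j_{k_1+1}j_{k_1}j)$, each entry of a cycle being mapped to the next; the rightmost cycle ends with $j$, every other cycle has its smallest element in the rightmost position, and $j_{k_2}<j_{k_3}<\cdots<j_{k_r}$.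 A fixed point $p$ contributes the factor $a_{pp}$. For Hermitian $B\in \mathrm{M}(n,\mathbf{H})$ all column determinants $\mathrm{cdet}_jB$ coincide and are real; the common value is denoted $\det B$. The double determinant of $A$ is $\mathrm{ddet}\,A:=\det(A^*A)$ (which equals $\det(AA^* )$). $B_{.j}(v)$ denotes the matrix obtained from $B$ by replacing its $j$th column with the column $v$. *)

theory Defs
  imports
    Complex_Main
    "HOL-Combinatorics.Combinatorics"
    "Jordan_Normal_Form.Matrix"
    "Jordan_Normal_Form.Determinant"
    "Jordan_Normal_Form.Conjugate"
begin

section \<open>The skew field of real quaternions\<close>

text \<open>\<open>Quat a b c d\<close> is $a + bi + cj + dk$.\<close>

datatype quat = Quat (qre: real) (qim1: real) (qim2: real) (qim3: real)

lemma quat_eq_iff: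
  "x = y \<longleftrightarrow> qre x = qre y \<and> qim1 x = qim1 y \<and> qim2 x = qim2 y \<and> qim3 x = qim3 y"
  by (cases x; cases y) auto

instantiation quat :: real_vector
begin

definition "0 = Quat 0 0 0 0"
definition "x + y = Quat (qre x + qre y) (qim1 x + qim1 y) (qim2 x + qim2 y) (qim3 x + qim3 y)"
definition "- x = Quat (- qre x) (- qim1 x) (- qim2 x) (- qim3 x)"
definition "x - y = Quat (qre x - qre y) (qim1 x - qim1 y) (qim2 x - qim2 y) (qim3 x - qim3 y)"
definition "r *\<^sub>R x = Quat (r * qre x) (r * qim1 x) (r * qim2 x) (r * qim3 x)"

instance
  by standard
    (simp_all add: quat_eq_iff zero_quat_def plus_quat_def uminus_quat_def minus_quat_def
      scaleR_quat_def algebra_simps)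

end

instantiation quat :: real_algebra_1
begin

definition "1 = Quat 1 0 0 0"
definition "x * y = Quat
  (qre x * qre y - qim1 x * qim1 y - qim2 x * qim2 y - qim3 x * qim3 y)
  (qre x * qim1 y + qim1 x * qre y + qim2 x * qim3 y - qim3 x * qim2 y)
  (qre x * qim2 y - qim1 x * qim3 y + qim2 x * qre y + qim3 x * qim1 y)
  (qre x * qim3 y + qim1 x * qim2 y - qim2 x * qim1 y + qim3 x * qre y)"

instance
  by standard
    (simp_all add: quat_eq_iff zero_quat_def one_quat_def plus_quat_def scaleR_quat_def
      times_quat_def algebra_simps)

end

instantiation quat :: conjugate
begin

definition "conjugate x = Quat (qre x) (- qim1 x) (- qim2 x) (- qim3 x)"

instance
  by standard (simp_all add: quat_eq_iff conjugate_quat_def)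

end

definition quat_norm_sq :: "quat \<Rightarrow> real" where
  "quat_norm_sq x = (qre x)\<^sup>2 + (qim1 x)\<^sup>2 + (qim2 x)\<^sup>2 + (qim3 x)\<^sup>2"

lemma quat_norm_sq_eq_0_iff: "quat_norm_sq x = 0 \<longleftrightarrow> x = 0"
  by (auto simp: quat_norm_sq_def quat_eq_iff zero_quat_def add_nonneg_eq_0_iff)

lemma quat_conjugate_mult: "conjugate x * x = of_real (quat_norm_sq x)"
  and quat_mult_conjugate: "x * conjugate x = of_real (quat_norm_sq x)"
  by (simp_all add: of_real_def quat_eq_iff conjugate_quat_def times_quat_def scaleR_quat_def
      one_quat_def quat_norm_sq_def power2_eq_square algebra_simps)

instantiation quat :: real_div_algebra
begin

definition "inverse x = conjugate x /\<^sub>R quat_norm_sq x" for x :: quat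
definition "x div y = x * inverse y" for x y :: quat

instance
proof
  fix x y :: quat
  show "x \<noteq> 0 \<Longrightarrow> inverse x * x = 1" "x \<noteq> 0 \<Longrightarrow> x * inverse x = 1"
    by (simp_all add: inverse_quat_def quat_conjugate_mult quat_mult_conjugate of_real_def
        quat_norm_sq_eq_0_iff)
  show "x div y = x * inverse y" by (rule divide_quat_def)
  show "inverse (0 :: quat) = 0"
    by (simp add: inverse_quat_def conjugate_quat_def zero_quat_def scaleR_quat_def)
qed

end

section \<open>Column determinants\<close>

text \<open>
  Matrices and vectors are those of \<open>Jordan_Normal_Form\<close>, so indices range over \<open>{0..<n}\<close>; only
  the order of the indices matters below. The operations \<open>A * B\<close> and \<open>A *\<^sub>v x\<close> put the entries
  of \<open>A\<close> on the left. \<open>mat_adjoint\<close> of that entry requires a commutative field.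
\<close>

definition conj_transpose :: "quat mat \<Rightarrow> quat mat" where
  "conj_transpose A = map_mat conjugate (transpose_mat A)"

text \<open>
  \<open>support \<tau> p\<close> is the list \<open>[p, \<tau> p, \<tau> (\<tau> p), \<dots>]\<close> of the elements of the cycle of \<open>p\<close>, so for a
  cycle $(q_l \ldots q_1\, p)$, in which each entry is mapped to the next one and \<open>p\<close> to $q_l$,
  the product below is $a_{p q_l} a_{q_l q_{l-1}} \cdots a_{q_2 q_1} a_{q_1 p}$. For a fixed
  point it is $a_{pp}$.
\<close>

definition cycle_prod :: "quat mat \<Rightarrow> (nat \<Rightarrow> nat) \<Rightarrow> nat \<Rightarrow> quat" where
  "cycle_prod A \<tau> p = prod_list (map (\<lambda>q. A $$ (q, \<tau> q)) (support \<tau> p))"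

definition num_cycles :: "nat \<Rightarrow> (nat \<Rightarrow> nat) \<Rightarrow> nat" where
  "num_cycles n \<tau> = card (orbit \<tau> ` {0..<n})"

text \<open>The smallest elements of the cycles not containing \<open>j\<close>.\<close>

definition cycle_minima :: "nat \<Rightarrow> nat \<Rightarrow> (nat \<Rightarrow> nat) \<Rightarrow> nat set" where
  "cycle_minima n j \<tau> = {p \<in> {0..<n}. j \<notin> orbit \<tau> p \<and> p = Min (orbit \<tau> p)}"

text \<open>
  The cycles not containing \<open>j\<close> stand from left to right in decreasing order of their smallest
  elements, hence \<open>rev\<close>; the cycle of \<open>j\<close> is the rightmost one.
\<close>

definition cdet :: "nat \<Rightarrow> quat mat \<Rightarrow> quat" where
  "cdet j A = (let n = dim_row A in
     \<Sum>\<tau> | \<tau> permutes {0..<n}.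
       (- 1) ^ (n - num_cycles n \<tau>) *
       prod_list (map (cycle_prod A \<tau>) (rev (sorted_list_of_set (cycle_minima n j \<tau>)))) *
       cycle_prod A \<tau> j)"

text \<open>
  The common real value of the column determinants, meaningful for a Hermitian matrix of positive
  size; \<open>ddet\<close> applies it to the Hermitian matrix $A^*A$.
\<close>

definition hermitian_det :: "quat mat \<Rightarrow> real" where
  "hermitian_det B = (THE d. \<forall>j < dim_row B. cdet j B = of_real d)"

definition ddet :: "quat mat \<Rightarrow> real" where
  "ddet A = hermitian_det (conj_transpose A * A)"

end

theory Submission
  imports Defs
begin

text \<open>
  Write \<open>B\<close> for the Hermitian matrix \<open>A\<^sup>* A\<close>. A solution of \<open>A x = y\<close> satisfies
  \<open>B x = f\<close> with \<open>f = A\<^sup>* y\<close>, that is, \<open>f\<close> is the combination of the columns of \<open>B\<close> with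
  coefficients \<open>x\<^sub>i\<close> on the right. In every term of \<open>cdet j\<close> the last factor, and only that one, is an
  entry of column \<open>j\<close>, so \<open>cdet j\<close> is right linear in that column, and Cramer's rule follows from two facts about
  a Hermitian matrix: its column determinants are all equal to one real number, and \<open>cdet j\<close>
  vanishes when column \<open>j\<close> is overwritten by another column.

  Both facts come from expanding along one cycle. A permutation of a finite index set \<open>S\<close> consists
  of the cycle \<open>j # xs\<close> of \<open>j\<close> and a permutation of the remaining indices, and the factors of the
  remaining cycles multiply to a term of \<open>det_on A (S - set (j # xs))\<close>, the ordered determinant of
  a principal submatrix (\<open>sum_permutes_eq_path_sum\<close>). For a Hermitian matrix, traversing a cycle
  backwards conjugates its product, so by induction on \<open>S\<close> all these sums are real and hence
  central (\<open>path_sum_real\<close>). To compare two indices \<open>i\<close> and \<open>j\<close>, separate the permutations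
  in which they lie on one cycle from those in which they lie on two. The resulting double sum for
  \<open>cdet j\<close> has real part symmetric in \<open>i\<close> and \<open>j\<close>, since the real part of a product does not
  depend on the order of two factors (\<open>hermitian_det_on\<close>). When column \<open>j\<close> holds a copy of column
  \<open>i\<close>, both kinds of permutations contribute the same products, with opposite signs
  (\<open>path_sum_repeated\<close>).

  Cramer's rule determines every solution, so in particular \<open>A z = 0\<close> forces \<open>z = 0\<close>. An injective
  square matrix over the quaternions is surjective, because it is an injective endomorphism of a
  finite-dimensional real vector space (\<open>quat_mat_injective_imp_surjective\<close>). Therefore a solution
  exists, and the formula describes exactly it.
\<close>

section \<open>Conjugation and real parts of quaternions\<close>

lemma quat_conjugate_times: "conjugate (x * y) = conjugate y * conjugate (x :: quat)"
  by (simp add: quat_eq_iff conjugate_quat_def times_quat_def algebra_simps)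

lemma quat_conjugate_add: "conjugate (x + y) = conjugate x + conjugate (y :: quat)"
  by (simp add: quat_eq_iff conjugate_quat_def plus_quat_def)

lemma quat_conjugate_zero: "conjugate (0 :: quat) = 0"
  by (simp add: quat_eq_iff conjugate_quat_def zero_quat_def)

lemma quat_conjugate_of_real: "conjugate (of_real r :: quat) = of_real r"
  by (simp add: quat_eq_iff conjugate_quat_def of_real_def scaleR_quat_def one_quat_def)

lemma quat_conjugate_one: "conjugate (1 :: quat) = 1"
  using quat_conjugate_of_real[of 1] by simp

lemma quat_conjugate_sum: "conjugate (sum f I) = (\<Sum>i\<in>I. conjugate (f i :: quat))"
  by (induction I rule: infinite_finite_induct)
    (simp_all add: quat_conjugate_add quat_conjugate_zero)

lemma quat_conjugate_fixed_iff: "conjugate x = x \<longleftrightarrow> x = of_real (qre x)"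
  by (auto simp: quat_eq_iff conjugate_quat_def of_real_def scaleR_quat_def one_quat_def)

lemma quat_of_real_commute: "of_real r * x = x * (of_real r :: quat)"
  by (simp add: of_real_def)

lemma qre_of_real [simp]: "qre (of_real r) = r"
  by (simp add: of_real_def scaleR_quat_def one_quat_def)

lemma qre_sum: "qre (sum f I) = (\<Sum>i\<in>I. qre (f i))"
  by (induction I rule: infinite_finite_induct) (simp_all add: plus_quat_def zero_quat_def)

lemma qre_diff: "qre (x - y) = qre x - qre y"
  by (simp add: minus_quat_def)

lemma qre_of_real_times: "qre (of_real r * x) = r * qre x"
  by (simp add: times_quat_def of_real_def scaleR_quat_def one_quat_def)

lemma qre_times_commute: "qre (x * y) = qre (y * x)"
  by (simp add: times_quat_def algebra_simps)

section \<open>Trails\<close>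

text \<open>
  The product of the entries along the steps of a walk. A cycle through \<open>j\<close> is the closed walk
  \<open>j # xs @ [j]\<close>.
\<close>

fun trail :: "('i \<Rightarrow> 'i \<Rightarrow> 'a :: monoid_mult) \<Rightarrow> 'i list \<Rightarrow> 'a" where
  "trail a (x # y # zs) = a x y * trail a (y # zs)"
| "trail a zs = 1"

lemma trail_split: "trail a (xs @ y # zs) = trail a (xs @ [y]) * trail a (y # zs)"
proof (induction xs rule: induct_list012)
  case (3 x y' xs)
  then show ?case by (simp add: mult.assoc)
qed (simp_all add: mult.assoc)

lemma trail_snoc: "xs \<noteq> [] \<Longrightarrow> trail a (xs @ [z]) = trail a xs * a (last xs) z"
  using trail_split[of a "butlast xs" "last xs" "[z]"]
  by (cases xs rule: rev_cases) (simp_all add: trail_split[of a _ _ "[z]"])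

lemma trail_cong:
  assumes "\<And>x y. x \<in> set xs \<Longrightarrow> y \<in> set (tl xs) \<Longrightarrow> a x y = b x y"
  shows "trail a xs = trail b xs"
  using assms by (induction xs rule: induct_list012) auto

text \<open>
  Conjugation reverses products and a Hermitian matrix turns conjugated entries into transposed
  ones, so together they reverse the walk.
\<close>

lemma conjugate_trail:
  fixes a :: "'i \<Rightarrow> 'i \<Rightarrow> quat"
  assumes "\<And>x y. x \<in> set xs \<Longrightarrow> y \<in> set xs \<Longrightarrow> conjugate (a x y) = a y x"
  shows "conjugate (trail a xs) = trail a (rev xs)"
  using assms
proof (induction xs rule: induct_list012)
  case (3 x y xs)
  then have "conjugate (trail a (x # y # xs)) = trail a (rev xs @ [y]) * a y x"
    by (simp add: quat_conjugate_times)
  then show ?case by (simp add: trail_split[of a _ y "[x]"])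
qed (simp_all add: quat_conjugate_one)

section \<open>Arcs\<close>

definition arcs :: "'i set \<Rightarrow> 'i list set" where
  "arcs T = {xs. distinct xs \<and> set xs \<subseteq> T}"

text \<open>The second list of a pair also avoids the entries of the first one.\<close>

definition arc_pairs :: "'i set \<Rightarrow> ('i list \<times> 'i list) set" where
  "arc_pairs T = (SIGMA xs : arcs T. arcs (T - set xs))"

lemma finite_arcs: "finite T \<Longrightarrow> finite (arcs T)"
  using finite_subset_distinct[of T] by (simp add: arcs_def conj_commute)

lemma sum_arcs_rev: "(\<Sum>xs\<in>arcs T. f (rev xs)) = (\<Sum>xs\<in>arcs T. f xs)"
  by (rule sum.reindex_bij_witness[of _ rev rev]) (auto simp: arcs_def)

lemma sum_arc_pairs:
  "finite T \<Longrightarrow> (\<Sum>xs\<in>arcs T. \<Sum>ys\<in>arcs (T - set xs). g xs ys) = (\<Sum>(xs, ys)\<in>arc_pairs T. g xs ys)"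
  unfolding arc_pairs_def by (intro sum.Sigma) (simp_all add: finite_arcs)

lemma sum_arc_pairs_swap:
  "(\<Sum>(xs, ys)\<in>arc_pairs T. g xs ys) = (\<Sum>(xs, ys)\<in>arc_pairs T. g ys xs)"
  by (rule sum.reindex_bij_witness[of _ prod.swap prod.swap])
    (auto simp: arc_pairs_def arcs_def)

text \<open>A list that contains \<open>i\<close> falls apart at its unique occurrence of \<open>i\<close> into a pair of arcs.\<close>

lemma sum_arcs_split:
  assumes "finite T" "i \<notin> T"
  shows "(\<Sum>xs\<in>arcs (insert i T). f xs) =
    (\<Sum>xs\<in>arcs T. f xs) + (\<Sum>(xs, ys)\<in>arc_pairs T. f (xs @ i # ys))"
proof -
  let ?cut = "\<lambda>(xs, ys). xs @ i # ys"
  have inj: "inj_on ?cut (arc_pairs T)"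
  proof (rule inj_onI, clarify)
    fix xs ys xs' ys'
    assume "(xs, ys) \<in> arc_pairs T" "(xs', ys') \<in> arc_pairs T" "xs @ i # ys = xs' @ i # ys'"
    moreover from this have "i \<notin> set xs" "i \<notin> set ys"
      using assms by (auto simp: arc_pairs_def arcs_def)
    ultimately show "xs = xs' \<and> ys = ys'"
      by (simp add: append_Cons_eq_iff)
  qed
  have "arcs (insert i T) = arcs T \<union> ?cut ` arc_pairs T"
  proof (intro equalityI subsetI)
    fix zs assume zs: "zs \<in> arcs (insert i T)"
    show "zs \<in> arcs T \<union> ?cut ` arc_pairs T"
    proof (cases "i \<in> set zs")
      case True
      then obtain xs ys where "zs = xs @ i # ys" by (auto simp: in_set_conv_decomp)
      with zs have "(xs, ys) \<in> arc_pairs T" by (auto simp: arc_pairs_def arcs_def)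
      with \<open>zs = _\<close> show ?thesis by force
    qed (use zs in \<open>auto simp: arcs_def\<close>)
  qed (use assms in \<open>auto simp: arc_pairs_def arcs_def\<close>)
  moreover have "arcs T \<inter> ?cut ` arc_pairs T = {}"
    using assms by (auto simp: arcs_def)
  moreover have "finite (arc_pairs T)"
    using assms by (simp add: arc_pairs_def finite_arcs)
  ultimately show ?thesis
    using inj assms
    by (simp add: sum.union_disjoint finite_arcs sum.reindex case_prod_unfold comp_def)
qed

section \<open>Splitting off the cycle of an element\<close>

text \<open>
  The column determinant at \<open>Min S\<close> of the principal submatrix on \<open>S\<close>, written without singling
  out a cycle: the cycle of \<open>Min S\<close> has the smallest minimum, so it is the rightmost one anyway.
  This form covers \<open>S = {}\<close>, where the value is \<open>1\<close>.
\<close>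

definition det_on :: "quat mat \<Rightarrow> nat set \<Rightarrow> quat" where
  "det_on A S = (\<Sum>\<sigma> | \<sigma> permutes S.
     (- 1) ^ (card S - card (orbit \<sigma> ` S)) *
     prod_list (map (cycle_prod A \<sigma>) (rev (sorted_list_of_set {p \<in> S. p = Min (orbit \<sigma> p)}))))"

abbreviation entry :: "'a mat \<Rightarrow> nat \<Rightarrow> nat \<Rightarrow> 'a" where
  "entry A p q \<equiv> A $$ (p, q)"

text \<open>
  For \<open>i = j\<close> this is the expansion of the column determinant at \<open>j\<close> along the cycle \<open>j # xs\<close>,
  whose sign is \<open>(- 1) ^ length xs\<close>. For \<open>i \<noteq> j\<close> the walk ends in \<open>i\<close>, which is the effect of
  replacing column \<open>j\<close> by column \<open>i\<close>.
\<close>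

definition path_sum :: "quat mat \<Rightarrow> nat set \<Rightarrow> nat \<Rightarrow> nat \<Rightarrow> quat" where
  "path_sum A S j i = (\<Sum>xs\<in>arcs (S - {j}).
     (- 1) ^ length xs * det_on A (S - set (j # xs)) * trail (entry A) (j # xs @ [i]))"

lemma det_on_empty: "det_on A {} = 1"
  by (simp add: det_on_def)

lemma prod_list_map_eq_trail:
  assumes "map f xs = tl xs @ [z]"
  shows "prod_list (map (\<lambda>q. a q (f q)) xs) = trail a (xs @ [z])"
  using assms by (induction xs rule: induct_list012) simp_all

text \<open>
  The permutation \<open>\<tau>\<close> glued together from a cycle and a permutation \<open>\<sigma>\<close> of the other indices acts
  as the one or the other, so its orbits, supports and sign can be read off from the two parts.
\<close>

context
  fixes S :: "'a set" and j :: 'a and xs :: "'a list" and \<sigma> \<tau> :: "'a \<Rightarrow> 'a"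
  assumes fin: "finite S" and j: "j \<in> S" and xs: "xs \<in> arcs (S - {j})"
    and \<sigma>: "\<sigma> permutes (S - set (j # xs))"
  defines "\<tau> \<equiv> cycle_of_list (j # xs) \<circ> \<sigma>"
begin

lemma glued_cycle_distinct: "distinct (j # xs)" and glued_cycle_subset: "set (j # xs) \<subseteq> S"
  using xs j by (auto simp: arcs_def)

lemma glued_permutes: "\<tau> permutes S"
  unfolding \<tau>_def
  by (rule permutes_compose[OF permutes_subset[OF \<sigma>] permutes_subset[OF cycle_permutes]])
    (use glued_cycle_subset in auto)

lemma glued_outside: "p \<in> S - set (j # xs) \<Longrightarrow> \<tau> p = \<sigma> p"
  using permutes_in_image[OF \<sigma>, of p] unfolding \<tau>_def comp_def
  by (intro id_outside_supp) auto

lemma glued_inside: "p \<in> set (j # xs) \<Longrightarrow> \<tau> p = cycle_of_list (j # xs) p"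
  unfolding \<tau>_def comp_def by (subst permutes_not_in[OF \<sigma>]) simp_all

lemma glued_funpow_outside:
  assumes "p \<in> S - set (j # xs)"
  shows "(\<tau> ^^ k) p = (\<sigma> ^^ k) p" and "(\<sigma> ^^ k) p \<in> S - set (j # xs)"
proof -
  have "(\<tau> ^^ k) p = (\<sigma> ^^ k) p \<and> (\<sigma> ^^ k) p \<in> S - set (j # xs)"
  proof (induction k)
    case (Suc k)
    then show ?case
      using glued_outside[of "(\<sigma> ^^ k) p"] permutes_in_image[OF \<sigma>, of "(\<sigma> ^^ k) p"] by simp
  qed (use assms in simp)
  then show "(\<tau> ^^ k) p = (\<sigma> ^^ k) p" "(\<sigma> ^^ k) p \<in> S - set (j # xs)" by blast+
qed

lemma glued_orbit_outside: "p \<in> S - set (j # xs) \<Longrightarrow> orbit \<tau> p = orbit \<sigma> p"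
  by (simp only: orbit_altdef glued_funpow_outside)

lemma glued_support_outside: "p \<in> S - set (j # xs) \<Longrightarrow> support \<tau> p = support \<sigma> p"
  by (simp only: least_power_def glued_funpow_outside)

lemma glued_funpow: "(\<tau> ^^ k) j = (j # xs) ! (k mod length (j # xs))"
proof -
  have "(\<tau> ^^ k) j = (cycle_of_list (j # xs) ^^ k) j"
  proof (induction k)
    case (Suc k)
    have "(cycle_of_list (j # xs) ^^ k) j \<in> set (j # xs)"
      using permutes_in_image[OF permutes_funpow[OF cycle_permutes[of "j # xs"]], of k j] by simp
    then show ?case
      using glued_inside Suc by simp
  qed simp
  also have "\<dots> = map (cycle_of_list (j # xs) ^^ k) (j # xs) ! 0"
    by simp
  also have "\<dots> = (j # xs) ! (k mod length (j # xs))"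
    unfolding cyclic_rotation[OF glued_cycle_distinct] by (subst nth_rotate) simp_all
  finally show ?thesis .
qed

lemma glued_least_power: "least_power \<tau> j = length (j # xs)"
  unfolding least_power_def
proof (rule Least_equality)
  show "(\<tau> ^^ length (j # xs)) j = j \<and> 0 < length (j # xs)"
    unfolding glued_funpow by simp
next
  fix k assume k: "(\<tau> ^^ k) j = j \<and> 0 < k"
  show "length (j # xs) \<le> k"
  proof (rule ccontr)
    assume "\<not> ?thesis"
    then have "(j # xs) ! k = (j # xs) ! 0" "k < length (j # xs)"
      using k unfolding glued_funpow by simp_all
    then show False
      using glued_cycle_distinct k by (simp only: nth_eq_iff_index_eq) simp
  qed
qed

lemma glued_support: "support \<tau> j = j # xs"
proof -
  have "support \<tau> j = map ((!) (j # xs)) [0..<length (j # xs)]"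
    unfolding glued_least_power by (intro map_cong refl) (simp only: glued_funpow, simp add: less_Suc_eq_le le_imp_less_Suc del: upt_Suc)
  then show ?thesis by (simp only: map_nth)
qed

lemma glued_orbit: "p \<in> set (j # xs) \<Longrightarrow> orbit \<tau> p = set (j # xs)"
proof -
  have "(\<tau> ^^ length (j # xs)) j = j"
    unfolding glued_funpow by simp
  then have "orbit \<tau> j = {(\<tau> ^^ m) j | m. m < length (j # xs)}"
    by (rule orbit_altdef_bounded) simp
  also have "\<dots> = set (support \<tau> j)"
    unfolding glued_least_power by (auto simp del: upt_Suc)
  finally have "orbit \<tau> j = set (j # xs)"
    unfolding glued_support .
  then have "cyclic_on \<tau> (set (j # xs))"
    by (auto simp: cyclic_on_def)
  then show "p \<in> set (j # xs) \<Longrightarrow> orbit \<tau> p = set (j # xs)"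
    by (rule orbit_cyclic_eq3)
qed

lemma glued_map: "map \<tau> (j # xs) = xs @ [j]"
proof -
  have "map \<tau> (j # xs) = map (cycle_of_list (j # xs) ^^ 1) (j # xs)"
    by (rule map_cong) (use glued_inside in auto)
  then show ?thesis
    unfolding cyclic_rotation[OF glued_cycle_distinct] by simp
qed

lemma glued_orbits:
  "orbit \<tau> ` S = insert (set (j # xs)) (orbit \<sigma> ` (S - set (j # xs)))"
  "set (j # xs) \<notin> orbit \<sigma> ` (S - set (j # xs))"
proof -
  have "S = set (j # xs) \<union> (S - set (j # xs))"
    using glued_cycle_subset by blast
  then have "orbit \<tau> ` S = orbit \<tau> ` set (j # xs) \<union> orbit \<tau> ` (S - set (j # xs))"
    by (metis image_Un)
  also have "orbit \<tau> ` set (j # xs) = {set (j # xs)}"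
    using glued_orbit by auto
  also have "orbit \<tau> ` (S - set (j # xs)) = orbit \<sigma> ` (S - set (j # xs))"
    by (rule image_cong[OF refl glued_orbit_outside])
  finally show "orbit \<tau> ` S = insert (set (j # xs)) (orbit \<sigma> ` (S - set (j # xs)))"
    by simp
  show "set (j # xs) \<notin> orbit \<sigma> ` (S - set (j # xs))"
  proof
    assume "set (j # xs) \<in> orbit \<sigma> ` (S - set (j # xs))"
    then obtain p where "p \<in> S - set (j # xs)" "set (j # xs) = orbit \<sigma> p" by blast
    then have "j \<in> S - set (j # xs)"
      using permutes_orbit_subset[OF \<sigma>, of p] by auto
    then show False by simp
  qed
qed

text \<open>The cycle \<open>j # xs\<close> adds \<open>Suc (length xs)\<close> indices but only one orbit.\<close>

lemma glued_sign:
  "(- 1 :: 'b :: ring_1) ^ (card S - card (orbit \<tau> ` S)) =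
   (- 1) ^ length xs * (- 1) ^ (card (S - set (j # xs)) - card (orbit \<sigma> ` (S - set (j # xs))))"
proof -
  let ?R = "S - set (j # xs)"
  have "card S = card (set (j # xs)) + card ?R"
    using card_Diff_subset[of "set (j # xs)" S] glued_cycle_subset fin
    by (metis List.finite_set card_mono le_add_diff_inverse)
  moreover have "card (set (j # xs)) = Suc (length xs)"
    using distinct_card[OF glued_cycle_distinct] by simp
  moreover have "card (orbit \<tau> ` S) = Suc (card (orbit \<sigma> ` ?R))"
    unfolding glued_orbits(1) using glued_orbits(2) fin by (intro card_insert_disjoint) simp_all
  moreover have "card (orbit \<sigma> ` ?R) \<le> card ?R"
    using fin by (intro card_image_le) simp
  ultimately have "card S - card (orbit \<tau> ` S) = length xs + (card ?R - card (orbit \<sigma> ` ?R))"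
    by simp
  then show ?thesis by (simp add: power_add)
qed

end

text \<open>
  Gluing is a bijection: the cycle of \<open>j\<close> is recovered from \<open>\<tau>\<close> as \<open>support \<tau> j\<close>, and the other
  part by restricting \<open>\<tau>\<close> to the remaining indices.
\<close>

lemma sum_permutes_by_cycle:
  assumes "finite S" "j \<in> S"
  shows "(\<Sum>\<tau> | \<tau> permutes S. F \<tau>) =
    (\<Sum>xs\<in>arcs (S - {j}). \<Sum>\<sigma> | \<sigma> permutes (S - set (j # xs)). F (cycle_of_list (j # xs) \<circ> \<sigma>))"
proof -
  let ?pairs = "SIGMA xs : arcs (S - {j}). {\<sigma>. \<sigma> permutes (S - set (j # xs))}"
  let ?glue = "\<lambda>(xs, \<sigma>). cycle_of_list (j # xs) \<circ> \<sigma>"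
  let ?cut = "\<lambda>\<tau>. (tl (support \<tau> j), \<lambda>p. if p \<in> S - set (support \<tau> j) then \<tau> p else p)"
  have "(\<Sum>\<tau> | \<tau> permutes S. F \<tau>) = (\<Sum>x\<in>?pairs. F (?glue x))"
  proof (rule sum.reindex_bij_witness[of _ ?glue ?cut])
    fix \<tau> assume "\<tau> \<in> {\<tau>. \<tau> permutes S}"
    then have \<tau>: "\<tau> permutes S" "permutation \<tau>"
      using \<open>finite S\<close> by (auto simp: permutation_permutes)
    then have pos: "0 < least_power \<tau> j"
      using least_power_of_permutation(2) by fast
    then have supp: "j # tl (support \<tau> j) = support \<tau> j"
      by (simp add: upt_conv_Cons)
    have "set (support \<tau> j) \<subseteq> S"
      using permutes_in_image[OF permutes_funpow[OF \<tau>(1)]] \<open>j \<in> S\<close> by auto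
    moreover have "distinct (support \<tau> j)"
      by (rule cycle_of_permutation[OF \<tau>(2)])
    ultimately have "set (j # tl (support \<tau> j)) \<subseteq> S" "distinct (j # tl (support \<tau> j))"
      unfolding supp .
    then have "tl (support \<tau> j) \<in> arcs (S - {j})"
      by (auto simp: arcs_def)
    moreover have "(\<lambda>p. if p \<in> S - set (support \<tau> j) then \<tau> p else p) permutes (S - set (support \<tau> j))"
      by (rule semidecomposition[OF \<tau>(1) \<open>finite S\<close>])
    ultimately show "?cut \<tau> \<in> ?pairs"
      by (simp only: mem_Sigma_iff mem_Collect_eq supp)
    show glue: "?glue (?cut \<tau>) = \<tau>"
    proof
      fix p
      consider "p \<in> S - set (support \<tau> j)" | "p \<in> set (support \<tau> j)" | "p \<notin> S" "p \<notin> set (support \<tau> j)"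
        by blast
      then show "?glue (?cut \<tau>) p = \<tau> p"
      proof cases
        case 1
        have "\<tau> p \<in> set (support \<tau> p)"
          unfolding support_set[OF \<tau>(2)] by (rule range_eqI[of _ _ 1]) simp
        then have "\<tau> p \<notin> set (support \<tau> j)"
          using 1 disjoint_support'[OF \<tau>(2), of p j] by blast
        then show ?thesis
          using 1 unfolding prod.case supp comp_def by (simp only: if_True simp_thms id_outside_supp)
      next
        case 2
        then show ?thesis
          using cycle_restrict[OF \<tau>(2)] unfolding prod.case supp comp_def by simp
      next
        case 3
        then show ?thesis
          using permutes_not_in[OF \<tau>(1)] unfolding prod.case supp comp_def
          by (simp only: id_outside_supp Diff_iff simp_thms if_False)
      qed
    qed
    show "F (?glue (?cut \<tau>)) = F \<tau>" by (simp only: glue)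
  next
    fix x assume "x \<in> ?pairs"
    then obtain xs \<sigma> where x: "x = (xs, \<sigma>)" "xs \<in> arcs (S - {j})" "\<sigma> permutes (S - set (j # xs))"
      by blast
    show "?glue x \<in> {\<tau>. \<tau> permutes S}"
      using glued_permutes[OF assms x(2,3)] x(1) by simp
    have "(\<lambda>p. if p \<in> S - set (j # xs) then (cycle_of_list (j # xs) \<circ> \<sigma>) p else p) = \<sigma>"
      using glued_outside[OF assms x(2,3)] permutes_not_in[OF x(3)] by (intro ext) auto
    then show "?cut (?glue x) = x"
      unfolding x(1) prod.case glued_support[OF assms x(2,3)] by simp
  qed
  also have "\<dots> = (\<Sum>xs\<in>arcs (S - {j}). \<Sum>\<sigma> | \<sigma> permutes (S - set (j # xs)).
      F (cycle_of_list (j # xs) \<circ> \<sigma>))"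
    using \<open>finite S\<close>
    by (subst sum.Sigma) (simp_all add: finite_arcs finite_permutations case_prod_unfold)
  finally show ?thesis .
qed

text \<open>
  The left-hand side is the column determinant at \<open>j\<close> of the principal submatrix on \<open>S\<close>. Splitting
  off the cycle of \<open>j\<close> leaves the minima of the other cycles unchanged, so their factors keep the
  order in which they occur in \<open>det_on\<close>.
\<close>

lemma sum_permutes_eq_path_sum:
  assumes "finite S" "j \<in> S"
  shows "(\<Sum>\<tau> | \<tau> permutes S. (- 1) ^ (card S - card (orbit \<tau> ` S)) *
      prod_list (map (cycle_prod A \<tau>)
        (rev (sorted_list_of_set {p \<in> S. j \<notin> orbit \<tau> p \<and> p = Min (orbit \<tau> p)}))) *
      cycle_prod A \<tau> j) = path_sum A S j j"
    (is "sum ?F _ = _")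
proof -
  have "?F (cycle_of_list (j # xs) \<circ> \<sigma>) = (- 1) ^ length xs *
      ((- 1) ^ (card (S - set (j # xs)) - card (orbit \<sigma> ` (S - set (j # xs)))) *
       prod_list (map (cycle_prod A \<sigma>) (rev (sorted_list_of_set
         {p \<in> S - set (j # xs). p = Min (orbit \<sigma> p)})))) * trail (entry A) (j # xs @ [j])"
    if xs: "xs \<in> arcs (S - {j})" and \<sigma>: "\<sigma> permutes (S - set (j # xs))" for xs \<sigma>
  proof -
    define \<tau> where "\<tau> = cycle_of_list (j # xs) \<circ> \<sigma>"
    note sign = glued_sign[OF assms xs \<sigma>, folded \<tau>_def]
      and support = glued_support[OF assms xs \<sigma>, folded \<tau>_def]
      and support_outside = glued_support_outside[OF assms xs \<sigma>, folded \<tau>_def]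
      and map_cycle = glued_map[OF assms xs \<sigma>, folded \<tau>_def]
      and orbit_inside = glued_orbit[OF assms xs \<sigma>, folded \<tau>_def]
      and orbit_outside = glued_orbit_outside[OF assms xs \<sigma>, folded \<tau>_def]
      and outside = glued_outside[OF assms xs \<sigma>, folded \<tau>_def]
      and funpow_outside = glued_funpow_outside[OF assms xs \<sigma>, folded \<tau>_def]
    have minima: "{p \<in> S. j \<notin> orbit \<tau> p \<and> p = Min (orbit \<tau> p)} =
        {p \<in> S - set (j # xs). p = Min (orbit \<sigma> p)}"
    proof (intro Collect_cong)
      fix p
      show "(p \<in> S \<and> j \<notin> orbit \<tau> p \<and> p = Min (orbit \<tau> p)) =
          (p \<in> S - set (j # xs) \<and> p = Min (orbit \<sigma> p))"
      proof (cases "p \<in> S - set (j # xs)")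
        case True
        have "j \<notin> orbit \<sigma> p"
          using permutes_orbit_subset[OF \<sigma> True] by auto
        with True show ?thesis
          unfolding orbit_outside[OF True] by blast
      next
        case False
        then have "p \<in> S \<Longrightarrow> j \<in> orbit \<tau> p"
          using orbit_inside[of p] by simp
        with False show ?thesis by blast
      qed
    qed
    have factor_outside: "cycle_prod A \<tau> p = cycle_prod A \<sigma> p" if "p \<in> S - set (j # xs)" for p
      unfolding cycle_prod_def support_outside[OF that]
      using funpow_outside(2)[OF that] outside
      by (intro arg_cong[of _ _ prod_list] map_cong refl) auto
    have "cycle_prod A \<tau> j = trail (entry A) ((j # xs) @ [j])"
      unfolding cycle_prod_def support
      by (rule prod_list_map_eq_trail) (use map_cycle in simp)
    moreover have "map (cycle_prod A \<tau>) (rev (sorted_list_of_set {p \<in> S - set (j # xs). p = Min (orbit \<sigma> p)})) =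
        map (cycle_prod A \<sigma>) (rev (sorted_list_of_set {p \<in> S - set (j # xs). p = Min (orbit \<sigma> p)}))"
      using factor_outside \<open>finite S\<close> by (intro map_cong refl) auto
    ultimately show ?thesis
      unfolding \<tau>_def[symmetric] minima sign by (simp only: mult.assoc append_Cons)
  qed
  then show ?thesis
    unfolding sum_permutes_by_cycle[OF assms] path_sum_def det_on_def sum_distrib_left sum_distrib_right
    by (intro sum.cong refl) simp_all
qed

lemma det_on_eq_path_sum:
  assumes "finite S" "S \<noteq> {}"
  shows "det_on A S = path_sum A S (Min S) (Min S)"
proof -
  let ?m = "Min S"
  have m: "?m \<in> S" using assms by (rule Min_in)
  have "prod_list (map (cycle_prod A \<tau>) (rev (sorted_list_of_set {p \<in> S. p = Min (orbit \<tau> p)}))) =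
      prod_list (map (cycle_prod A \<tau>)
        (rev (sorted_list_of_set {p \<in> S. ?m \<notin> orbit \<tau> p \<and> p = Min (orbit \<tau> p)}))) *
      cycle_prod A \<tau> ?m" if \<tau>: "\<tau> permutes S" for \<tau>
  proof -
    let ?M = "{p \<in> S. p = Min (orbit \<tau> p)}"
    have sub: "orbit \<tau> p \<subseteq> S" if "p \<in> S" for p
      using permutes_orbit_subset[OF \<tau> that] .
    have self: "p \<in> orbit \<tau> p" for p
      using \<tau> assms by (intro permutation_self_in_orbit) (auto simp: permutation_permutes)
    have min: "Min (orbit \<tau> p) = ?m" if "p \<in> S" "?m \<in> orbit \<tau> p" for p
      using sub[OF that(1)] that assms by (intro Min_eqI) (auto intro: finite_subset)
    have mM: "?m \<in> ?M" using m min[OF m self] by simp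
    then have "Min ?M = ?m"
      using assms by (intro Min_eqI[OF _ _ mM]) auto
    moreover have "?M - {?m} = {p \<in> S. ?m \<notin> orbit \<tau> p \<and> p = Min (orbit \<tau> p)}"
      using min self by auto
    moreover have "sorted_list_of_set ?M = Min ?M # sorted_list_of_set (?M - {Min ?M})"
    proof (rule sorted_list_of_set_nonempty)
      show "finite ?M" using assms by simp
      show "?M \<noteq> {}" using mM by blast
    qed
    ultimately have "sorted_list_of_set ?M =
        ?m # sorted_list_of_set {p \<in> S. ?m \<notin> orbit \<tau> p \<and> p = Min (orbit \<tau> p)}"
      by simp
    then show ?thesis by simp
  qed
  then have "det_on A S = (\<Sum>\<tau> | \<tau> permutes S. (- 1) ^ (card S - card (orbit \<tau> ` S)) *
      prod_list (map (cycle_prod A \<tau>)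
        (rev (sorted_list_of_set {p \<in> S. ?m \<notin> orbit \<tau> p \<and> p = Min (orbit \<tau> p)}))) *
      cycle_prod A \<tau> ?m)"
    unfolding det_on_def by (intro sum.cong refl) (simp only: mem_Collect_eq mult.assoc)
  then show ?thesis
    by (simp only: sum_permutes_eq_path_sum[OF assms(1) m])
qed

lemma cdet_eq_path_sum: "j < dim_row A \<Longrightarrow> cdet j A = path_sum A {0..<dim_row A} j j"
  using sum_permutes_eq_path_sum[of "{0..<dim_row A}" j A]
  by (simp add: cdet_def Let_def num_cycles_def cycle_minima_def)

section \<open>Determinants of Hermitian matrices\<close>

definition hermitian_on :: "nat set \<Rightarrow> quat mat \<Rightarrow> bool" where
  "hermitian_on S A \<longleftrightarrow> (\<forall>p\<in>S. \<forall>q\<in>S. conjugate (A $$ (p, q)) = A $$ (q, p))"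

lemma hermitian_on_subset: "hermitian_on S A \<Longrightarrow> T \<subseteq> S \<Longrightarrow> hermitian_on T A"
  by (auto simp: hermitian_on_def)

lemma minus_one_power_of_real: "(- 1 :: quat) ^ k = of_real ((- 1) ^ k)"
  by simp

text \<open>
  Reversing \<open>xs\<close> keeps the sign and the complementary determinant and conjugates the product along
  the cycle, so the whole sum is its own conjugate.
\<close>

lemma path_sum_real:
  assumes "hermitian_on S A" "j \<in> S"
    and real: "\<And>T. T \<subset> S \<Longrightarrow> det_on A T = of_real (qre (det_on A T))"
  shows "path_sum A S j j = of_real (qre (path_sum A S j j))"
proof -
  let ?c = "\<lambda>xs. (- 1) ^ length xs * qre (det_on A (S - set (j # xs)))"
  have sub: "S - set (j # xs) \<subset> S" for xs
    using \<open>j \<in> S\<close> by auto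
  have path: "path_sum A S j j =
      (\<Sum>xs\<in>arcs (S - {j}). of_real (?c xs) * trail (entry A) (j # xs @ [j]))"
    unfolding path_sum_def by (intro sum.cong refl) (subst real[OF sub], simp only: of_real_mult minus_one_power_of_real)
  have "conjugate (path_sum A S j j) =
      (\<Sum>xs\<in>arcs (S - {j}). of_real (?c (rev xs)) * trail (entry A) (j # rev xs @ [j]))"
    unfolding path quat_conjugate_sum
  proof (rule sum.cong[OF refl])
    fix xs assume "xs \<in> arcs (S - {j})"
    then have "set (j # xs @ [j]) \<subseteq> S"
      using \<open>j \<in> S\<close> by (auto simp: arcs_def)
    then have "conjugate (trail (entry A) (j # xs @ [j])) = trail (entry A) (rev (j # xs @ [j]))"
      using \<open>hermitian_on S A\<close> by (intro conjugate_trail) (auto simp: hermitian_on_def)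
    then show "conjugate (of_real (?c xs) * trail (entry A) (j # xs @ [j])) =
        of_real (?c (rev xs)) * trail (entry A) (j # rev xs @ [j])"
      by (simp only: quat_conjugate_times quat_conjugate_of_real quat_of_real_commute) simp
  qed
  also have "\<dots> = path_sum A S j j"
    unfolding path by (rule sum_arcs_rev)
  finally show ?thesis by (simp add: quat_conjugate_fixed_iff)
qed

text \<open>
  The first sum collects the walks from \<open>j\<close> that avoid \<open>i\<close>, the second one those that pass
  through \<open>i\<close>, cut there into two walks. The index \<open>i\<close> itself adds one step, whence the minus
  sign.
\<close>

lemma path_sum_two_cycles:
  assumes "finite S" "i \<in> S" "j \<in> S" "i \<noteq> j"
  shows "path_sum A S j k =
    (\<Sum>xs\<in>arcs (S - {i, j}). (- 1) ^ length xs * det_on A (S - set (j # xs)) * trail (entry A) (j # xs @ [k]))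
    - (\<Sum>(xs, ys)\<in>arc_pairs (S - {i, j}). (- 1) ^ (length xs + length ys) *
        det_on A (S - {i, j} - set xs - set ys) *
        (trail (entry A) (j # xs @ [i]) * trail (entry A) (i # ys @ [k])))"
proof -
  have S: "S - {j} = insert i (S - {i, j})"
    using assms by auto
  have D: "S - set (j # xs @ i # ys) = S - {i, j} - set xs - set ys" for xs ys
    by auto
  have T: "trail (entry A) (j # (xs @ i # ys) @ [k]) =
      trail (entry A) (j # xs @ [i]) * trail (entry A) (i # ys @ [k])" for xs ys
    using trail_split[of "entry A" "j # xs" i "ys @ [k]"] by simp
  show ?thesis
    using assms(1) unfolding path_sum_def S
    by (subst sum_arcs_split) (simp_all only: D T, simp_all add: case_prod_unfold sum_negf[symmetric])
qed

text \<open>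
  Realness and independence of the index are proved together because independence on \<open>S\<close> rests on
  both statements for smaller sets. In the sum over walks from \<open>j\<close> that avoid \<open>i\<close>, the
  complementary determinant is expanded along the cycle of \<open>i\<close>, so that \<open>path_sum A S j j\<close> becomes one sum over pairs of
  disjoint arcs. The summand compares two closed walks, one at \<open>i\<close> and one at \<open>j\<close>, with the single
  closed walk through both; taking real parts allows the factors to be interchanged.
\<close>

lemma hermitian_det_on:
  assumes "finite S" "hermitian_on S A"
  shows "det_on A S = of_real (qre (det_on A S)) \<and> (\<forall>j\<in>S. path_sum A S j j = det_on A S)"
  using assms
proof (induction S rule: finite_psubset_induct)
  case (psubset S)
  have real: "det_on A T = of_real (qre (det_on A T))"
    and expand: "\<And>i. i \<in> T \<Longrightarrow> path_sum A T i i = det_on A T" if "T \<subset> S" for T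
    using psubset.IH[OF that] that psubset.prems hermitian_on_subset[of S A T] by auto
  have path_real: "path_sum A S j j = of_real (qre (path_sum A S j j))" if "j \<in> S" for j
    using path_sum_real[OF psubset.prems that real] .
  have symmetric: "path_sum A S j j = path_sum A S i i" if "i \<in> S" "j \<in> S" for i j
  proof (cases "i = j")
    case False
    let ?t = "\<lambda>j xs i. trail (entry A) (j # xs @ [i])"
    let ?d = "\<lambda>T xs ys. (- 1) ^ (length xs + length ys) * qre (det_on A (T - set xs - set ys))"
    have formula: "qre (path_sum A S j j) = (\<Sum>(xs, ys)\<in>arc_pairs (S - {i, j}).
        ?d (S - {i, j}) xs ys * (qre (?t j xs j * ?t i ys i) - qre (?t j xs i * ?t i ys j)))"
      if "i \<in> S" "j \<in> S" "i \<noteq> j" for i j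
    proof -
      let ?T = "S - {i, j}"
      have fin: "finite ?T" using psubset.hyps by simp
      have d: "(- 1) ^ (length xs + length ys) * det_on A (?T - set xs - set ys) =
          of_real (?d ?T xs ys)" for xs ys
        using that by (subst real) auto
      have "(\<Sum>xs\<in>arcs ?T. (- 1) ^ length xs * det_on A (S - set (j # xs)) * ?t j xs j) =
          (\<Sum>xs\<in>arcs ?T. \<Sum>ys\<in>arcs (?T - set xs). of_real (?d ?T xs ys) * (?t i ys i * ?t j xs j))"
      proof (rule sum.cong[OF refl])
        fix xs assume "xs \<in> arcs ?T"
        then have i: "i \<in> S - set (j # xs)"
          using that by (auto simp: arcs_def)
        have sub: "S - set (j # xs) \<subset> S"
          using that by auto
        have S: "S - set (j # xs) - {i} = ?T - set xs"
            "\<And>ys. S - set (j # xs) - set (i # ys) = ?T - set xs - set ys"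
          by auto
        have "(- 1) ^ length xs * det_on A (S - set (j # xs)) * ?t j xs j =
            (- 1) ^ length xs * path_sum A (S - set (j # xs)) i i * ?t j xs j"
          by (simp only: expand[OF sub i])
        also have "\<dots> = (\<Sum>ys\<in>arcs (?T - set xs).
            ((- 1) ^ (length xs + length ys) * det_on A (?T - set xs - set ys)) * (?t i ys i * ?t j xs j))"
          by (simp only: path_sum_def S sum_distrib_left sum_distrib_right power_add mult.assoc)
        finally show "(- 1) ^ length xs * det_on A (S - set (j # xs)) * ?t j xs j =
            (\<Sum>ys\<in>arcs (?T - set xs). of_real (?d ?T xs ys) * (?t i ys i * ?t j xs j))"
          by (simp only: d)
      qed
      then have "path_sum A S j j = (\<Sum>(xs, ys)\<in>arc_pairs ?T.
          of_real (?d ?T xs ys) * (?t i ys i * ?t j xs j - ?t j xs i * ?t i ys j))"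
        unfolding path_sum_two_cycles[OF psubset.hyps that, of A j] d sum_arc_pairs[OF fin]
        by (simp only: right_diff_distrib sum_subtractf case_prod_unfold)
      then show ?thesis
        by (simp only: qre_sum case_prod_unfold qre_of_real_times qre_diff
            qre_times_commute[of "?t i _ i"])
    qed
    \<comment> \<open>Exchanging the two arcs of a pair exchanges the roles of \<open>i\<close> and \<open>j\<close>.\<close>
    have "qre (path_sum A S i i) = (\<Sum>(ys, xs)\<in>arc_pairs (S - {j, i}).
        ?d (S - {j, i}) ys xs * (qre (?t i ys i * ?t j xs j) - qre (?t i ys j * ?t j xs i)))"
      using that False by (intro formula) auto
    also have "\<dots> = (\<Sum>(xs, ys)\<in>arc_pairs (S - {j, i}).
        ?d (S - {j, i}) ys xs * (qre (?t i ys i * ?t j xs j) - qre (?t i ys j * ?t j xs i)))"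
      by (rule sum_arc_pairs_swap)
    also have "\<dots> = qre (path_sum A S j j)"
      unfolding formula[OF that False]
    proof (intro sum.cong)
      have "S - {j, i} - set ys - set xs = S - {i, j} - set xs - set ys" for xs ys
        by auto
      then have "?d (S - {j, i}) ys xs * (qre (?t i ys i * ?t j xs j) - qre (?t i ys j * ?t j xs i)) =
          ?d (S - {i, j}) xs ys * (qre (?t j xs j * ?t i ys i) - qre (?t j xs i * ?t i ys j))" for xs ys
        by (simp only: add.commute qre_times_commute[of "?t i ys i"] qre_times_commute[of "?t i ys j"])
      then show "(case p of (xs, ys) \<Rightarrow>
            ?d (S - {j, i}) ys xs * (qre (?t i ys i * ?t j xs j) - qre (?t i ys j * ?t j xs i))) =
          (case p of (xs, ys) \<Rightarrow>
            ?d (S - {i, j}) xs ys * (qre (?t j xs j * ?t i ys i) - qre (?t j xs i * ?t i ys j)))" for p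
        by (simp only: split_beta)
    qed (simp only: insert_commute)
    finally show ?thesis
      using path_real[OF that(1)] path_real[OF that(2)] by (simp only:)
  qed simp
  have D: "det_on A S = path_sum A S j j" if "j \<in> S" for j
  proof -
    have S: "S \<noteq> {}" using that by auto
    have "det_on A S = path_sum A S (Min S) (Min S)"
      by (rule det_on_eq_path_sum[OF psubset.hyps S])
    also have "\<dots> = path_sum A S j j"
      by (rule symmetric[OF that Min_in[OF psubset.hyps S]])
    finally show ?thesis .
  qed
  show ?case
  proof (cases "S = {}")
    case True
    then show ?thesis
      by (simp add: det_on_empty one_quat_def)
  next
    case False
    then obtain j where "j \<in> S" by auto
    then have "det_on A S = of_real (qre (det_on A S))"
      using path_real[of j] by (simp only: D)
    with D show ?thesis by simp
  qed
qed

text \<open>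
  Expanding the complementary determinant along the cycle of \<open>i\<close> turns a walk from \<open>j\<close> to \<open>i\<close> that
  has not met \<open>i\<close> before into that walk together with a closed walk at \<open>i\<close>. A walk that has met
  \<open>i\<close> before is the same pair, traversed in one go and counted with the opposite sign. The
  determinant is real, so it can be moved past the first walk.
\<close>

lemma path_sum_repeated:
  assumes "finite S" "hermitian_on S A" "i \<in> S" "j \<in> S" "i \<noteq> j"
  shows "path_sum A S j i = 0"
proof -
  let ?T = "S - {i, j}"
  let ?t = "\<lambda>j xs i. trail (entry A) (j # xs @ [i])"
  have fin: "finite ?T" using assms by simp
  have "(\<Sum>xs\<in>arcs ?T. (- 1) ^ length xs * det_on A (S - set (j # xs)) * ?t j xs i) =
    (\<Sum>xs\<in>arcs ?T. \<Sum>ys\<in>arcs (?T - set xs). (- 1) ^ (length xs + length ys) *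
        det_on A (?T - set xs - set ys) * (?t j xs i * ?t i ys i))"
  proof (rule sum.cong[OF refl])
    fix xs assume xs: "xs \<in> arcs ?T"
    let ?U = "S - set (j # xs)"
    have i: "i \<in> ?U"
      using assms xs by (auto simp: arcs_def)
    have U: "finite ?U" "hermitian_on ?U A"
      using assms hermitian_on_subset[of S A ?U] by auto
    note det = hermitian_det_on[OF U]
    have S: "?U - {i} = ?T - set xs"
        "\<And>ys. ?U - set (i # ys) = ?T - set xs - set ys"
      by auto
    have real: "det_on A (?T - set xs - set ys) = of_real (qre (det_on A (?T - set xs - set ys)))" for ys
      using hermitian_det_on[of "?T - set xs - set ys" A] assms
        hermitian_on_subset[of S A "?T - set xs - set ys"] by auto
    obtain r where r: "det_on A ?U = of_real r"
      using det by blast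
    then have "path_sum A ?U i i = of_real r"
      using det i by auto
    then have "(- 1) ^ length xs * det_on A ?U * ?t j xs i = (- 1) ^ length xs * (?t j xs i * path_sum A ?U i i)"
      by (simp only: r mult.assoc quat_of_real_commute[of r "?t j xs i"])
    also have "\<dots> =
      (\<Sum>ys\<in>arcs (?T - set xs). (- 1) ^ (length xs + length ys) *
        det_on A (?T - set xs - set ys) * (?t j xs i * ?t i ys i))"
      unfolding path_sum_def S sum_distrib_left
    proof (rule sum.cong[OF refl])
      fix ys
      obtain r where r: "det_on A (?T - set xs - set ys) = of_real r"
        using real by blast
      show "(- 1) ^ length xs * (?t j xs i * ((- 1) ^ length ys * det_on A (?T - set xs - set ys) * ?t i ys i)) =
        (- 1) ^ (length xs + length ys) * det_on A (?T - set xs - set ys) * (?t j xs i * ?t i ys i)"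
        unfolding r minus_one_power_of_real of_real_mult[symmetric]
        by (simp add: of_real_def power_add)
    qed
    finally show "(- 1) ^ length xs * det_on A ?U * ?t j xs i = \<dots>" .
  qed
  then show ?thesis
    unfolding path_sum_two_cycles[OF assms(1,3,4,5), of A i] sum_arc_pairs[OF fin, symmetric]
    by simp
qed

section \<open>Cramer's rule for Hermitian matrices\<close>

lemma det_on_cong:
  assumes "finite S" "\<And>p q. p \<in> S \<Longrightarrow> q \<in> S \<Longrightarrow> A $$ (p, q) = B $$ (p, q)"
  shows "det_on A S = det_on B S"
proof -
  have "cycle_prod A \<sigma> p = cycle_prod B \<sigma> p" if "\<sigma> permutes S" "p \<in> S" for \<sigma> p
  proof -
    have "(\<sigma> ^^ k) p \<in> S" for k
      using permutes_in_image[OF permutes_funpow[OF that(1)]] that(2) by simp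
    moreover from this have "\<sigma> ((\<sigma> ^^ k) p) \<in> S" for k
      using permutes_in_image[OF that(1)] by simp
    ultimately show ?thesis
      unfolding cycle_prod_def by (intro arg_cong[of _ _ prod_list] map_cong refl assms(2)) auto
  qed
  then have "map (cycle_prod A \<sigma>) (rev (sorted_list_of_set {p \<in> S. p = Min (orbit \<sigma> p)})) =
      map (cycle_prod B \<sigma>) (rev (sorted_list_of_set {p \<in> S. p = Min (orbit \<sigma> p)}))"
    if "\<sigma> permutes S" for \<sigma>
    using that \<open>finite S\<close> by (intro map_cong refl) auto
  then show ?thesis
    unfolding det_on_def by (intro sum.cong refl) (simp only: mem_Collect_eq)
qed

text \<open>
  Right linearity in column \<open>j\<close>: only the last step of the cycle of \<open>j\<close> uses that column, and the
  other cycles avoid both row and column \<open>j\<close>.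
\<close>

lemma cdet_replace_col_mult:
  assumes B: "B \<in> carrier_mat n n" and x: "x \<in> carrier_vec n" and j: "j < n"
  shows "cdet j (replace_col B (B *\<^sub>v x) j) = (\<Sum>i<n. path_sum B {0..<n} j i * x $ i)"
proof -
  let ?S = "{0..<n}"
  let ?M = "replace_col B (B *\<^sub>v x) j"
  have dim: "dim_row ?M = n"
    using B by (simp add: replace_col_def)
  have old: "?M $$ (p, q) = B $$ (p, q)" if "p < n" "q < n" "q \<noteq> j" for p q
    using B that by (simp add: replace_col_def)
  have new: "?M $$ (p, j) = (\<Sum>i<n. B $$ (p, i) * x $ i)" if "p < n" for p
    using B x j that by (simp add: replace_col_def scalar_prod_def atLeast0LessThan)
  have "(- 1) ^ length xs * det_on ?M (?S - set (j # xs)) * trail (entry ?M) (j # xs @ [j]) =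
      (\<Sum>i<n. (- 1) ^ length xs * det_on B (?S - set (j # xs)) * trail (entry B) (j # xs @ [i]) * x $ i)"
    if "xs \<in> arcs (?S - {j})" for xs
  proof -
    have xs: "set xs \<subseteq> ?S - {j}"
      using that by (simp add: arcs_def)
    have D: "det_on ?M (?S - set (j # xs)) = det_on B (?S - set (j # xs))"
      using old by (intro det_on_cong) auto
    have T: "trail (entry ?M) (j # xs) = trail (entry B) (j # xs)"
    proof (rule trail_cong)
      fix p q assume "p \<in> set (j # xs)" "q \<in> set (tl (j # xs))"
      then have "p < n" "q < n" "q \<noteq> j"
        using xs j by auto
      then show "?M $$ (p, q) = B $$ (p, q)" by (rule old)
    qed
    have snoc: "trail (entry M) (j # xs @ [i]) = trail (entry M) (j # xs) * M $$ (last (j # xs), i)" for M i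
      using trail_snoc[of "j # xs" "entry M" i] by simp
    have "last (j # xs) \<in> set (j # xs)"
      by (rule last_in_set) simp
    then have "last (j # xs) < n"
      using xs j by auto
    then show ?thesis
      unfolding snoc D T by (simp only: new sum_distrib_left mult.assoc)
  qed
  then have "path_sum ?M ?S j j =
      (\<Sum>xs\<in>arcs (?S - {j}). \<Sum>i<n. (- 1) ^ length xs * det_on B (?S - set (j # xs)) *
        trail (entry B) (j # xs @ [i]) * x $ i)"
    unfolding path_sum_def by (intro sum.cong refl)
  also have "\<dots> = (\<Sum>i<n. path_sum B ?S j i * x $ i)"
    unfolding path_sum_def sum_distrib_right by (rule sum.swap)
  finally show ?thesis
    using cdet_eq_path_sum[of j ?M] j unfolding dim by simp
qed

lemma hermitian_det_eq:
  assumes B: "B \<in> carrier_mat n n" "hermitian_on {0..<n} B" and "0 < n"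
  shows "of_real (hermitian_det B) = det_on B {0..<n}"
proof -
  have dim: "dim_row B = n" using B by simp
  have cdet: "cdet j B = of_real (qre (det_on B {0..<n}))" if "j < n" for j
    using hermitian_det_on[OF _ B(2)] cdet_eq_path_sum[of j B] that dim by simp
  have "hermitian_det B = qre (det_on B {0..<n})"
    unfolding hermitian_det_def dim
  proof (rule the_equality)
    fix d assume "\<forall>j<n. cdet j B = of_real d"
    with cdet \<open>0 < n\<close> show "d = qre (det_on B {0..<n})" by force
  qed (use cdet in blast)
  then show ?thesis
    using hermitian_det_on[OF _ B(2)] by simp
qed

lemma hermitian_cramer:
  assumes B: "B \<in> carrier_mat n n" "hermitian_on {0..<n} B"
    and x: "x \<in> carrier_vec n" and j: "j < n"
  shows "cdet j (replace_col B (B *\<^sub>v x) j) = of_real (hermitian_det B) * x $ j"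
proof -
  have "path_sum B {0..<n} j i * x $ i = (if i = j then det_on B {0..<n} * x $ j else 0)"
    if "i < n" for i
    using hermitian_det_on[OF _ B(2)] path_sum_repeated[OF _ B(2), of i j] that j by auto
  then have "(\<Sum>i<n. path_sum B {0..<n} j i * x $ i) = det_on B {0..<n} * x $ j"
    using j by simp
  then show ?thesis
    using hermitian_det_eq[OF B] j cdet_replace_col_mult[OF B(1) x j] by simp
qed

section \<open>Injective quaternionic matrices are surjective\<close>

definition quat_coord :: "nat \<Rightarrow> quat \<Rightarrow> real" where
  "quat_coord b q = [qre q, qim1 q, qim2 q, qim3 q] ! b"

definition quat_unit :: "nat \<Rightarrow> quat" where
  "quat_unit b = [Quat 1 0 0 0, Quat 0 1 0 0, Quat 0 0 1 0, Quat 0 0 0 1] ! b"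

text \<open>
  A vector of \<open>n\<close> quaternions is stored as \<open>4 n\<close> reals in \<open>n\<close> consecutive blocks of length \<open>4\<close>.
\<close>

definition real_coords :: "quat vec \<Rightarrow> real vec" where
  "real_coords z = vec (dim_vec z * 4) (\<lambda>r. quat_coord (r mod 4) (z $ (r div 4)))"

definition of_real_coords :: "nat \<Rightarrow> real vec \<Rightarrow> quat vec" where
  "of_real_coords n v = vec n (\<lambda>k. \<Sum>b<4. v $ (k * 4 + b) *\<^sub>R quat_unit b)"

text \<open>
  The matrix of left multiplication by \<open>A\<close> as a real-linear map; the block of \<open>(i, k)\<close> has as its
  columns the coordinates of the entry of \<open>A\<close> at \<open>(i, k)\<close> times the basis quaternions.
\<close>

definition real_matrix :: "quat mat \<Rightarrow> real mat" where
  "real_matrix A = mat (dim_row A * 4) (dim_col A * 4)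
     (\<lambda>(r, c). quat_coord (r mod 4) (A $$ (r div 4, c div 4) * quat_unit (c mod 4)))"

lemma less_4_cases: "(b :: nat) < 4 \<Longrightarrow> b = 0 \<or> b = 1 \<or> b = 2 \<or> b = 3"
  by auto

lemma sum_lessThan_4: "sum f {..<4 :: nat} = f 0 + f 1 + f 2 + f 3"
  by (simp add: numeral_eq_Suc)

lemma quat_coord_add: "b < 4 \<Longrightarrow> quat_coord b (p + q) = quat_coord b p + quat_coord b q"
  by (auto simp: quat_coord_def plus_quat_def dest!: less_4_cases)

lemma quat_coord_zero: "b < 4 \<Longrightarrow> quat_coord b 0 = 0"
  by (auto simp: quat_coord_def zero_quat_def dest!: less_4_cases)

lemma quat_coord_scaleR: "b < 4 \<Longrightarrow> quat_coord b (r *\<^sub>R q) = r * quat_coord b q"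
  by (auto simp: quat_coord_def scaleR_quat_def dest!: less_4_cases)

lemma quat_coord_sum: "b < 4 \<Longrightarrow> quat_coord b (sum f I) = (\<Sum>i\<in>I. quat_coord b (f i))"
  by (induction I rule: infinite_finite_induct) (simp_all add: quat_coord_add quat_coord_zero)

lemma quat_coord_unit:
  assumes "a < 4" "b < 4"
  shows "quat_coord a (quat_unit b) = (if a = b then 1 else 0)"
  using less_4_cases[OF assms(1)] less_4_cases[OF assms(2)]
  by (elim disjE) (simp_all add: quat_coord_def quat_unit_def)

lemma sum_quat_coord_unit: "(\<Sum>b<4. quat_coord b q *\<^sub>R quat_unit b) = q"
  by (simp add: sum_lessThan_4 quat_coord_def quat_unit_def quat_eq_iff plus_quat_def scaleR_quat_def)

lemma of_real_coords_real_coords: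
  assumes "z \<in> carrier_vec n"
  shows "of_real_coords n (real_coords z) = z"
proof (rule eq_vecI)
  fix k assume "k < dim_vec z"
  then have "k < n" using assms by simp
  have "real_coords z $ (k * 4 + b) = quat_coord b (z $ k)" if "b < 4" for b
    using that assms \<open>k < n\<close> by (simp add: real_coords_def)
  then show "of_real_coords n (real_coords z) $ k = z $ k"
    using \<open>k < n\<close> by (simp add: of_real_coords_def sum_quat_coord_unit)
qed (use assms in \<open>simp add: of_real_coords_def\<close>)

lemma real_coords_of_real_coords:
  assumes "v \<in> carrier_vec (n * 4)"
  shows "real_coords (of_real_coords n v) = v"
proof (rule eq_vecI)
  fix r assume "r < dim_vec v"
  then have r: "r < n * 4" "r div 4 < n" using assms by (auto simp: less_mult_imp_div_less)
  have "real_coords (of_real_coords n v) $ r =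
      (\<Sum>b<4. v $ (r div 4 * 4 + b) * quat_coord (r mod 4) (quat_unit b))"
    using r by (simp add: real_coords_def of_real_coords_def quat_coord_sum quat_coord_scaleR)
  also have "\<dots> = (\<Sum>b<4. if r mod 4 = b then v $ (r div 4 * 4 + b) else 0)"
    by (intro sum.cong) (auto simp: quat_coord_unit)
  also have "\<dots> = v $ r" by simp
  finally show "real_coords (of_real_coords n v) $ r = v $ r" .
qed (use assms in \<open>simp add: real_coords_def of_real_coords_def\<close>)

lemma real_matrix_mult_vec:
  assumes A: "A \<in> carrier_mat n n" and v: "v \<in> carrier_vec (n * 4)"
  shows "real_matrix A *\<^sub>v v = real_coords (A *\<^sub>v of_real_coords n v)"
proof (rule eq_vecI)
  fix r assume "r < dim_vec (real_coords (A *\<^sub>v of_real_coords n v))"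
  then have r: "r < n * 4" "r div 4 < n"
    using A by (auto simp: real_coords_def less_mult_imp_div_less)
  let ?g = "\<lambda>c. quat_coord (r mod 4) (A $$ (r div 4, c div 4) * quat_unit (c mod 4)) * v $ c"
  have "(real_matrix A *\<^sub>v v) $ r = sum ?g {..<n * 4}"
    using A v r by (simp add: real_matrix_def scalar_prod_def atLeast0LessThan)
  also have "\<dots> = (\<Sum>k<n. sum ?g {k * 4..<k * 4 + 4})"
    by (rule sum.nat_group[symmetric])
  also have "\<dots> = (\<Sum>k<n. \<Sum>b<4. ?g (k * 4 + b))"
  proof (rule sum.cong[OF refl])
    fix k
    show "sum ?g {k * 4..<k * 4 + 4} = (\<Sum>b<4. ?g (k * 4 + b))"
      using sum.shift_bounds_nat_ivl[of ?g 0 "k * 4" 4] by (simp add: atLeast0LessThan add.commute)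
  qed
  also have "\<dots> = (\<Sum>k<n. quat_coord (r mod 4) (A $$ (r div 4, k) * (of_real_coords n v $ k)))"
    by (intro sum.cong refl)
      (simp add: of_real_coords_def sum_distrib_left quat_coord_sum quat_coord_scaleR mult.commute)
  also have "\<dots> = real_coords (A *\<^sub>v of_real_coords n v) $ r"
    using A r
    by (simp add: real_coords_def scalar_prod_def of_real_coords_def quat_coord_sum[symmetric] atLeast0LessThan)
  finally show "(real_matrix A *\<^sub>v v) $ r = real_coords (A *\<^sub>v of_real_coords n v) $ r" .
qed (use A in \<open>simp add: real_matrix_def real_coords_def\<close>)

text \<open>
  A singular real matrix would have a nonzero kernel vector, hence so would \<open>A\<close>. A regular one is
  invertible, and its inverse provides the preimage.
\<close>

lemma quat_mat_injective_imp_surjective: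
  fixes A :: "quat mat"
  assumes A: "A \<in> carrier_mat n n" and y: "y \<in> carrier_vec n"
    and inj: "\<And>z. z \<in> carrier_vec n \<Longrightarrow> A *\<^sub>v z = 0\<^sub>v n \<Longrightarrow> z = 0\<^sub>v n"
  obtains x where "x \<in> carrier_vec n" "A *\<^sub>v x = y"
proof -
  let ?R = "real_matrix A"
  have R: "?R \<in> carrier_mat (n * 4) (n * 4)"
    using A by (simp add: real_matrix_def)
  have carrier: "of_real_coords n v \<in> carrier_vec n" for v
    by (simp add: of_real_coords_def)
  have zero: "of_real_coords n (0\<^sub>v (n * 4)) = 0\<^sub>v n"
  proof (rule eq_vecI)
    fix k assume "k < dim_vec (0\<^sub>v n :: quat vec)"
    then have "k * 4 + b < n * 4" if "b < 4" for b
      using that by simp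
    then show "of_real_coords n (0\<^sub>v (n * 4)) $ k = 0\<^sub>v n $ k"
      using \<open>k < _\<close> by (simp add: of_real_coords_def)
  qed (simp add: of_real_coords_def)
  have "det ?R \<noteq> 0"
  proof
    assume "det ?R = 0"
    then obtain v where v: "v \<in> carrier_vec (n * 4)" "v \<noteq> 0\<^sub>v (n * 4)" "?R *\<^sub>v v = 0\<^sub>v (n * 4)"
      using det_0_iff_vec_prod_zero_field[OF R] by blast
    have "A *\<^sub>v of_real_coords n v = of_real_coords n (?R *\<^sub>v v)"
      unfolding real_matrix_mult_vec[OF A v(1)]
      by (rule of_real_coords_real_coords[OF mult_mat_vec_carrier[OF A carrier], symmetric])
    then have "of_real_coords n v = 0\<^sub>v n"
      using v(3) zero carrier inj by simp
    moreover have "real_coords (0\<^sub>v n) = 0\<^sub>v (n * 4)"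
      using real_coords_of_real_coords[of "0\<^sub>v (n * 4)" n] zero by simp
    ultimately have "v = 0\<^sub>v (n * 4)"
      using real_coords_of_real_coords[OF v(1)] by simp
    with v(2) show False ..
  qed
  then have "?R \<in> Units (ring_mat TYPE(real) (n * 4) ())"
    by (rule det_non_zero_imp_unit[OF R])
  then obtain C where "C \<in> carrier (ring_mat TYPE(real) (n * 4) ())"
      "?R \<otimes>\<^bsub>ring_mat TYPE(real) (n * 4) ()\<^esub> C = \<one>\<^bsub>ring_mat TYPE(real) (n * 4) ()\<^esub>"
    unfolding Units_def by blast
  then have C: "C \<in> carrier_mat (n * 4) (n * 4)" "?R * C = 1\<^sub>m (n * 4)"
    by (simp_all only: ring_mat_simps)
  have yc: "real_coords y \<in> carrier_vec (n * 4)"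
    using y by (intro carrier_vecI) (simp add: real_coords_def)
  let ?v = "C *\<^sub>v real_coords y"
  have v: "?v \<in> carrier_vec (n * 4)"
    by (rule mult_mat_vec_carrier[OF C(1) yc])
  have "real_coords (A *\<^sub>v of_real_coords n ?v) = (?R * C) *\<^sub>v real_coords y"
    unfolding real_matrix_mult_vec[OF A v, symmetric]
    by (rule assoc_mult_mat_vec[OF R C(1) yc, symmetric])
  also have "\<dots> = real_coords y"
    unfolding C(2) by (rule one_mult_mat_vec[OF yc])
  finally have eq: "real_coords (A *\<^sub>v of_real_coords n ?v) = real_coords y" .
  have "A *\<^sub>v of_real_coords n ?v = of_real_coords n (real_coords (A *\<^sub>v of_real_coords n ?v))"
    by (rule of_real_coords_real_coords[OF mult_mat_vec_carrier[OF A carrier], symmetric])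
  also have "\<dots> = y"
    unfolding eq by (rule of_real_coords_real_coords[OF y])
  finally show ?thesis
    using that carrier by blast
qed

section \<open>Cramer's rule\<close>

lemma conj_transpose_carrier: "A \<in> carrier_mat n n \<Longrightarrow> conj_transpose A \<in> carrier_mat n n"
  by (simp add: conj_transpose_def)

lemma hermitian_conj_transpose_mult:
  assumes "A \<in> carrier_mat n n"
  shows "hermitian_on {0..<n} (conj_transpose A * A)"
proof -
  have "(conj_transpose A * A) $$ (p, q) = (\<Sum>r<n. conjugate (A $$ (r, p)) * A $$ (r, q))"
    if "p < n" "q < n" for p q
    using assms that by (simp add: conj_transpose_def scalar_prod_def atLeast0LessThan)
  then show ?thesis
    by (simp add: hermitian_on_def quat_conjugate_sum quat_conjugate_times)
qed

theorem theorem9p1: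
  fixes A :: "quat mat" and y :: "quat vec" and n :: nat
  assumes "A \<in> carrier_mat n n"
    and "y \<in> carrier_vec n"
    and "ddet A \<noteq> 0"
  shows "\<forall>x \<in> carrier_vec n. A *\<^sub>v x = y \<longleftrightarrow>
    (\<forall>j < n. x $ j =
      cdet j (replace_col (conj_transpose A * A) (conj_transpose A *\<^sub>v y) j)
        / of_real (ddet A))"
proof -
  let ?H = "conj_transpose A"
  let ?B = "?H * A"
  let ?d = "of_real (ddet A) :: quat"
  have H: "?H \<in> carrier_mat n n"
    using assms(1) by (rule conj_transpose_carrier)
  have B: "?B \<in> carrier_mat n n"
    using H assms(1) by simp
  have cramer: "z $ j = cdet j (replace_col ?B (?H *\<^sub>v (A *\<^sub>v z)) j) / ?d"
    if z: "z \<in> carrier_vec n" and "j < n" for z j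
  proof -
    have "?B *\<^sub>v z = ?H *\<^sub>v (A *\<^sub>v z)"
      using H assms(1) z by simp
    then have "cdet j (replace_col ?B (?H *\<^sub>v (A *\<^sub>v z)) j) = z $ j * ?d"
      using hermitian_cramer[OF B hermitian_conj_transpose_mult[OF assms(1)] that]
      by (simp add: ddet_def quat_of_real_commute)
    moreover have "?d * inverse ?d = 1"
      using assms(3) by (intro right_inverse) simp
    ultimately show ?thesis
      by (simp only: divide_inverse mult.assoc mult_1_right)
  qed
  have "z = 0\<^sub>v n" if z: "z \<in> carrier_vec n" "A *\<^sub>v z = 0\<^sub>v n" for z
  proof -
    have "A *\<^sub>v z = A *\<^sub>v 0\<^sub>v n"
      unfolding z(2) using assms(1) by (intro eq_vecI) (simp_all add: scalar_prod_def)
    then have "z $ j = 0\<^sub>v n $ j" if "j < n" for j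
      using cramer[OF z(1) that] cramer[OF zero_carrier_vec that] by (simp only:)
    then show ?thesis
      using z(1) by (intro eq_vecI) simp_all
  qed
  \<comment> \<open>The formula says that \<open>x\<close> agrees with this solution in every component.\<close>
  then obtain s where s: "s \<in> carrier_vec n" "A *\<^sub>v s = y"
    using quat_mat_injective_imp_surjective[OF assms(1,2)] by blast
  show ?thesis
  proof (intro ballI iffI allI impI)
    fix x j assume "x \<in> carrier_vec n" "A *\<^sub>v x = y" "j < n"
    then show "x $ j = cdet j (replace_col ?B (?H *\<^sub>v y) j) / ?d"
      using cramer[of x j] by (simp only:)
  next
    fix x assume x: "x \<in> carrier_vec n"
      and "\<forall>j<n. x $ j = cdet j (replace_col ?B (?H *\<^sub>v y) j) / ?d"
    then have "x $ j = s $ j" if "j < n" for j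
      using cramer[OF s(1) that] that by (simp only: s(2))
    then have "x = s"
      using s(1) x by (intro eq_vecI) simp_all
    with s show "A *\<^sub>v x = y" by simp
  qed
qed

end
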